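(* Let $X\neq\{\theta\}$ and $Y$ be Banach spaces and let $A\in\mathcal{FSS}(X,Y)$ be a finitely strictly singular operator. Then $\mathcal{FSS}\lambda[A,\theta]=0$, where $\theta$ is the null operator from $X$ to $Y$.
   Context: Conventions: $\mathbb{N}'$ is an infinite subset of $\mathbb{N}$, $\mathbb{N}''$ an infinite subset of $\mathbb{N}'$, $\mathbb{N}'''$ an infinite subset of $\mathbb{N}''$, etc.; limits are taken along these index sets. $\theta$ denotes the null element of a Banach space and also the null operator. $\mathcal{B}(X,Y)$ is the space of bounded linear operators defined on all of $X$. $A\in\mathcal{B}(X,Y)$ is finitely strictly singular, $A\in\mathcal{FSS}(X,Y)$, if for every $\varepsilon>0$ there exists $n\in\mathbb{N}$ such that for every subspace $Z\subset X$ with $\dim Z\ge n$ there exists $z\in Z$ with $\|Az\|<\varepsilon\|z\|$. Uniform $\lambda$-adjustment. Let $(M_n)_{\mathbb{N}'}$, $(P_n)_{\mathbb{N}'}$ be sequences of closed subspaces of a Banach space $E$ with $M_n\neq\{\theta\}$ for all $n$, and let $\lambda\ge 0$. $(M_n)_{\mathbb{N}'}$ is lower uniformly $\lambda$-adjusted with $(P_n)_{\mathbb{N}'}$ if for every $\eta>0$, every infinite $\mathbb{N}''\subset\mathbb{N}'$ and all unit vectors $x_n\in M_n$ ($n\in\mathbb{N}''$), there exist an infinite $\mathbb{N}'''\subset\mathbb{N}''$, vectors $y_n\in P_n$ ($n\in\mathbb{N}'''$) and a vector $z\in E$ such that $\varlimsup_{n\in\mathbb{N}'''}\|x_n-y_n-z\|\le\lambda+\eta$.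 $\lambda_{\mathbb{N}'}[M_n,P_n]$ is the infimum of all such $\lambda$. Finitely strictly singular uniform $\lambda$-adjustment. $\mathcal{FSS}\lambda_{\mathbb{N}'}[M_n,P_n]$ is the infimum of all $\lambda\ge0$ such that: for every infinite $\mathbb{N}''\subset\mathbb{N}'$ and all subspaces $K_n\subset M_n$ with $\dim K_n<\infty$ ($n\in\mathbb{N}''$) and $\lim_{n\in\mathbb{N}''}\dim K_n=\infty$, there exist an infinite $\mathbb{N}'''\subset\mathbb{N}''$ and nonzero subspaces $L_n\subset K_n$ ($n\in\mathbb{N}'''$) with $\lim_{n\in\mathbb{N}'''}\dim L_n=\infty$ and $\lambda_{\mathbb{N}'''}[L_n,P_n]\le\lambda$. For operators, $\mathcal{FSS}\lambda_{\mathbb{N}'}[A_n,B_n]:=\mathcal{FSS}\lambda_{\mathbb{N}'}[G_{A_n},G_{B_n}]$, where $G_A=\{(x,Ax)\mid x\in X\}\subset X\times Y$ is the graph and $X\times Y$ carries the norm $\max\{\|x\|,\|y\|\}$. For single operators, $\mathcal{FSS}\lambda[A,B]$ is this number for the constant sequences $A_n=A$, $B_n=B$. *)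

theory Defs
  imports "HOL-Analysis.Analysis"
begin

section \<open>Banach spaces over the real or complex scalars\<close>

text \<open>
  The library class of Banach spaces only knows real scalars. To cover complex spaces as well
  (where subspaces and dimensions are complex ones), the scalar field is a type of the class
  below and the scalar multiplication is an explicit parameter, as in the library locale
  \<^locale>\<open>vector_space\<close>. A normed field which is at most two-dimensional over the reals
  is a copy of the real or of the complex numbers.
\<close>

class real_or_complex = real_normed_field +
  assumes scalar_decomposition: "\<exists>i. \<forall>z. \<exists>a b. z = a *\<^sub>R 1 + b *\<^sub>R i"

instance real :: real_or_complex
proof
  have "\<forall>z::real. \<exists>a b. z = a *\<^sub>R 1 + b *\<^sub>R 0" by simp
  then show "\<exists>i. \<forall>z::real. \<exists>a b. z = a *\<^sub>R 1 + b *\<^sub>R i" ..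
qed

instance complex :: real_or_complex
proof
  have "z = Re z *\<^sub>R 1 + Im z *\<^sub>R \<i>" for z :: complex
    by (simp add: complex_eq_iff)
  then show "\<exists>i. \<forall>z::complex. \<exists>a b. z = a *\<^sub>R 1 + b *\<^sub>R i" by blast
qed

text \<open>
  Completeness comes from the class \<^class>\<open>banach\<close>. The norm is homogeneous for the scalars
  of the field, and the built-in real scalar multiplication of the type is the restriction of
  \<open>sE\<close>.
\<close>

locale banach_space_over = vector_space sE
  for sE :: "'k::real_or_complex \<Rightarrow> 'a::banach \<Rightarrow> 'a" +
  assumes norm_scale: "norm (sE c x) = norm c * norm x"
    and scale_of_real: "sE (of_real r) x = r *\<^sub>R x"

lemma banach_space_over_scaleR: "banach_space_over (scaleR :: real \<Rightarrow> 'a::banach \<Rightarrow> 'a)"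
  by unfold_locales (simp_all add: algebra_simps)

lemma banach_space_over_complex: "banach_space_over ((*) :: complex \<Rightarrow> complex \<Rightarrow> complex)"
  by unfold_locales (simp_all add: algebra_simps norm_mult scaleR_conv_of_real)

text \<open>
  The library dimension of an infinite-dimensional subspace is \<open>0\<close>, so finiteness of the
  dimension has to be tracked separately.
\<close>

definition finite_dim :: "('k::field \<Rightarrow> 'a::ab_group_add \<Rightarrow> 'a) \<Rightarrow> 'a set \<Rightarrow> bool" where
  "finite_dim sE V \<longleftrightarrow> (\<exists>B. finite B \<and> V \<subseteq> module.span sE B)"

definition dim_at_least :: "('k::field \<Rightarrow> 'a::ab_group_add \<Rightarrow> 'a) \<Rightarrow> 'a set \<Rightarrow> nat \<Rightarrow> bool" where
  "dim_at_least sE V n \<longleftrightarrow> \<not> finite_dim sE V \<or> n \<le> vector_space.dim sE V"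


section \<open>Operators\<close>

definition bounded_operator ::
  "('k::real_or_complex \<Rightarrow> 'a::banach \<Rightarrow> 'a) \<Rightarrow> ('k \<Rightarrow> 'b::banach \<Rightarrow> 'b) \<Rightarrow> ('a \<Rightarrow> 'b) \<Rightarrow> bool" where
  "bounded_operator sX sY A \<longleftrightarrow>
     Vector_Spaces.linear sX sY A \<and> (\<exists>C. \<forall>x. norm (A x) \<le> C * norm x)"

definition finitely_strictly_singular ::
  "('k::real_or_complex \<Rightarrow> 'a::banach \<Rightarrow> 'a) \<Rightarrow> ('k \<Rightarrow> 'b::banach \<Rightarrow> 'b) \<Rightarrow> ('a \<Rightarrow> 'b) \<Rightarrow> bool" where
  "finitely_strictly_singular sX sY A \<longleftrightarrow>
     bounded_operator sX sY A \<and>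
     (\<forall>\<epsilon>>0. \<exists>n. \<forall>Z. module.subspace sX Z \<and> dim_at_least sX Z n \<longrightarrow>
        (\<exists>z\<in>Z. norm (A z) < \<epsilon> * norm z))"


section \<open>Uniform adjustment of sequences of subspaces\<close>

text \<open>
  The filter \<open>along N\<close> describes limits along an infinite index set \<open>N\<close>. Sequences indexed by
  \<open>N\<close> are total functions of which only the values at indices in \<open>N\<close> matter.
\<close>

definition along :: "nat set \<Rightarrow> nat filter" where
  "along N = inf sequentially (principal N)"

definition lower_uniformly_adjusted ::
  "nat set \<Rightarrow> (nat \<Rightarrow> 'e::banach set) \<Rightarrow> (nat \<Rightarrow> 'e set) \<Rightarrow> real \<Rightarrow> bool" where
  "lower_uniformly_adjusted N M P l \<longleftrightarrow>
     (\<forall>\<eta>>0. \<forall>N2 x. N2 \<subseteq> N \<and> infinite N2 \<and> (\<forall>n\<in>N2. x n \<in> M n \<and> norm (x n) = 1) \<longrightarrow>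
        (\<exists>N3 y z. N3 \<subseteq> N2 \<and> infinite N3 \<and> (\<forall>n\<in>N3. y n \<in> P n) \<and>
           Limsup (along N3) (\<lambda>n. ereal (norm (x n - y n - z))) \<le> ereal (l + \<eta>)))"

text \<open>
  For sequences of subspaces, \<open>l = 1\<close> belongs to the two sets below, as one may take
  \<open>y n = 0\<close> and \<open>z = 0\<close>; hence both infima are taken over nonempty sets bounded below.
\<close>

definition uniform_lambda ::
  "nat set \<Rightarrow> (nat \<Rightarrow> 'e::banach set) \<Rightarrow> (nat \<Rightarrow> 'e set) \<Rightarrow> real" where
  "uniform_lambda N M P = Inf {l. 0 \<le> l \<and> lower_uniformly_adjusted N M P l}"

definition FSS_lambda ::
  "('k::real_or_complex \<Rightarrow> 'e::banach \<Rightarrow> 'e) \<Rightarrow>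
   nat set \<Rightarrow> (nat \<Rightarrow> 'e set) \<Rightarrow> (nat \<Rightarrow> 'e set) \<Rightarrow> real" where
  "FSS_lambda sE N M P = Inf {l. 0 \<le> l \<and>
     (\<forall>N2 K. N2 \<subseteq> N \<and> infinite N2 \<and>
        (\<forall>n\<in>N2. module.subspace sE (K n) \<and> K n \<subseteq> M n \<and> finite_dim sE (K n)) \<and>
        filterlim (\<lambda>n. vector_space.dim sE (K n)) at_top (along N2) \<longrightarrow>
        (\<exists>N3 L. N3 \<subseteq> N2 \<and> infinite N3 \<and>
           (\<forall>n\<in>N3. module.subspace sE (L n) \<and> L n \<subseteq> K n \<and> L n \<noteq> {0}) \<and>
           filterlim (\<lambda>n. vector_space.dim sE (L n)) at_top (along N3) \<and>
           uniform_lambda N3 L P \<le> l))}"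


section \<open>Products with the maximum norm\<close>

text \<open>The library norm on the product type is the Euclidean one, so a separate type is needed.\<close>

datatype ('a, 'b) max_prod = MaxPair (mfst: 'a) (msnd: 'b)

instantiation max_prod :: (real_normed_vector, real_normed_vector) real_normed_vector
begin

definition "0 = MaxPair 0 0"
definition "p + q = MaxPair (mfst p + mfst q) (msnd p + msnd q)"
definition "p - q = MaxPair (mfst p - mfst q) (msnd p - msnd q)"
definition "- p = MaxPair (- mfst p) (- msnd p)"
definition "r *\<^sub>R p = MaxPair (r *\<^sub>R mfst p) (r *\<^sub>R msnd p)"
definition norm_max_prod_def: "norm p = max (norm (mfst p)) (norm (msnd p))"
definition sgn_max_prod_def: "sgn (p :: ('a, 'b) max_prod) = inverse (norm p) *\<^sub>R p"
definition dist_max_prod_def: "dist (p :: ('a, 'b) max_prod) q = norm (p - q)"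
definition uniformity_max_prod_def:
  "(uniformity :: (('a, 'b) max_prod \<times> ('a, 'b) max_prod) filter) =
     (INF e\<in>{0 <..}. principal {(p, q). dist p q < e})"
definition open_max_prod_def:
  "open (U :: ('a, 'b) max_prod set) \<longleftrightarrow>
     (\<forall>p\<in>U. eventually (\<lambda>(p', q). p' = p \<longrightarrow> q \<in> U) uniformity)"

lemmas max_prod_arith_defs =
  zero_max_prod_def plus_max_prod_def minus_max_prod_def uminus_max_prod_def scaleR_max_prod_def

instance
proof
  fix p q :: "('a, 'b) max_prod" and r :: real
  show "norm p = 0 \<longleftrightarrow> p = 0"
    by (cases p) (auto simp: norm_max_prod_def max_prod_arith_defs max_def)
  show "norm (p + q) \<le> norm p + norm q"
    using norm_triangle_ineq[of "mfst p" "mfst q"] norm_triangle_ineq[of "msnd p" "msnd q"]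
    by (auto simp: norm_max_prod_def max_prod_arith_defs max_def)
  show "norm (r *\<^sub>R p) = \<bar>r\<bar> * norm p"
    by (simp add: norm_max_prod_def max_prod_arith_defs max_mult_distrib_left)
qed (simp_all add: max_prod_arith_defs sgn_max_prod_def dist_max_prod_def
       uniformity_max_prod_def open_max_prod_def algebra_simps)

end

instance max_prod :: (banach, banach) banach
proof
  fix X :: "nat \<Rightarrow> ('a, 'b) max_prod"
  assume X: "Cauchy X"
  have le: "dist (mfst p) (mfst q) \<le> dist p q" "dist (msnd p) (msnd q) \<le> dist p q"
    for p q :: "('a, 'b) max_prod"
    by (simp_all add: dist_max_prod_def norm_max_prod_def minus_max_prod_def dist_norm)
  have "Cauchy (\<lambda>n. mfst (X n))" "Cauchy (\<lambda>n. msnd (X n))"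
    using X le unfolding Cauchy_def by (meson le_less_trans)+
  then obtain a b where "(\<lambda>n. mfst (X n)) \<longlonglongrightarrow> a" "(\<lambda>n. msnd (X n)) \<longlonglongrightarrow> b"
    by (meson Cauchy_convergent convergent_def)
  then have "(\<lambda>n. max (norm (mfst (X n) - a)) (norm (msnd (X n) - b))) \<longlonglongrightarrow> max 0 0"
    by (intro tendsto_max tendsto_norm_zero LIM_zero)
  then have "X \<longlonglongrightarrow> MaxPair a b"
    by (subst tendsto_dist_iff)
      (simp add: dist_max_prod_def norm_max_prod_def minus_max_prod_def)
  then show "convergent X" by (auto simp: convergent_def)
qed

definition max_prod_scale ::
  "('k \<Rightarrow> 'a \<Rightarrow> 'a) \<Rightarrow> ('k \<Rightarrow> 'b \<Rightarrow> 'b) \<Rightarrow> 'k \<Rightarrow> ('a, 'b) max_prod \<Rightarrow> ('a, 'b) max_prod" where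
  "max_prod_scale sX sY c p = MaxPair (sX c (mfst p)) (sY c (msnd p))"

lemma banach_space_over_max_prod:
  assumes "banach_space_over sX" "banach_space_over sY"
  shows "banach_space_over (max_prod_scale sX sY)"
proof -
  interpret X: banach_space_over sX by fact
  interpret Y: banach_space_over sY by fact
  show ?thesis
    by unfold_locales
      (simp_all add: max_prod_scale_def max_prod_arith_defs norm_max_prod_def
        X.norm_scale Y.norm_scale X.scale_of_real Y.scale_of_real max_mult_distrib_left
        X.scale_right_distrib Y.scale_right_distrib X.scale_left_distrib Y.scale_left_distrib)
qed


section \<open>Adjustment of operators\<close>

definition op_graph :: "('a \<Rightarrow> 'b) \<Rightarrow> ('a, 'b) max_prod set" where
  "op_graph A = range (\<lambda>x. MaxPair x (A x))"

definition FSS_lambda_op_seq ::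
  "('k::real_or_complex \<Rightarrow> 'a::banach \<Rightarrow> 'a) \<Rightarrow> ('k \<Rightarrow> 'b::banach \<Rightarrow> 'b) \<Rightarrow>
   nat set \<Rightarrow> (nat \<Rightarrow> 'a \<Rightarrow> 'b) \<Rightarrow> (nat \<Rightarrow> 'a \<Rightarrow> 'b) \<Rightarrow> real" where
  "FSS_lambda_op_seq sX sY N A B =
     FSS_lambda (max_prod_scale sX sY) N (\<lambda>n. op_graph (A n)) (\<lambda>n. op_graph (B n))"

definition FSS_lambda_op ::
  "('k::real_or_complex \<Rightarrow> 'a::banach \<Rightarrow> 'a) \<Rightarrow> ('k \<Rightarrow> 'b::banach \<Rightarrow> 'b) \<Rightarrow>
   ('a \<Rightarrow> 'b) \<Rightarrow> ('a \<Rightarrow> 'b) \<Rightarrow> real" where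
  "FSS_lambda_op sX sY A B = FSS_lambda_op_seq sX sY UNIV (\<lambda>_. A) (\<lambda>_. B)"

end

theory Submission
  imports Defs
begin

text \<open>
  The point is that a finitely strictly singular \<open>A\<close> is small on whole subspaces: for all \<open>d\<close> and
  \<open>\<epsilon>\<close>, every finite-dimensional subspace of sufficiently large dimension contains a
  \<open>d\<close>-dimensional one on which \<open>\<parallel>A x\<parallel> \<le> \<epsilon> \<parallel>x\<parallel>\<close>. By induction on \<open>d\<close>: pick one
  vector \<open>z\<close> on which \<open>A\<close> is small, use the Hahn-Banach theorem to find a hyperplane \<open>H\<close> with
  \<open>\<parallel>c z\<parallel> \<le> \<parallel>c z + h\<parallel>\<close> for \<open>h \<in> H\<close>, and continue inside \<open>H\<close>; since the projection onto
  the span of \<open>z\<close> along \<open>H\<close> has norm 1, each step costs only a factor 3. A diagonal choice then yields \<open>L n \<subseteq> K n\<close> with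
  \<open>dim (L n) \<rightarrow> \<infinity>\<close> on which \<open>A\<close> has norm tending to 0, and a unit vector \<open>(x, A x)\<close> of the
  graph lying in \<open>L n\<close> is approximated by \<open>(x, 0)\<close>.
\<close>

section \<open>Hahn-Banach extension and norming functionals\<close>

text \<open>The one-dimensional Hahn-Banach step: domination by the norm forces lower and upper
  bounds on the value at \<open>b\<close>, and the triangle inequality leaves room between them.
  Linearity of \<open>g\<close> is global, domination only holds on the enlarged span.\<close>

lemma dominated_extension:
  fixes f :: "'a::real_normed_vector \<Rightarrow> real"
  assumes f: "linear f" and S: "subspace S" and dom: "\<And>x. x \<in> S \<Longrightarrow> f x \<le> norm x"
  shows "\<exists>g. linear g \<and> (\<forall>x\<in>S. g x = f x) \<and> (\<forall>x\<in>span (insert b S). g x \<le> norm x)"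
proof (cases "b \<in> S")
  case True
  then show ?thesis
    using assms by (intro exI[of _ f]) (simp add: insert_absorb span_eq_iff[THEN iffD2])
next
  case False
  obtain B where B: "B \<subseteq> S" "independent B" "S = span B"
    using basis_exists[of S] S by (metis span_subspace)
  have "independent (insert b B)"
    using B False by (simp add: independent_insert)
  \<comment> \<open>\<open>h\<close> is a coordinate functional for \<open>b\<close> that vanishes
    on \<open>S\<close>, so adding a multiple of it to \<open>f\<close> changes nothing on
    \<open>S\<close>.\<close>
  then obtain h :: "'a \<Rightarrow> real"
    where h: "linear h" "\<And>x. x \<in> insert b B \<Longrightarrow> h x = (if x = b then 1 else 0)"
    using linear_independent_extend[of "insert b B" "\<lambda>x. if x = b then 1 else 0 :: real"] by blast
  have hS: "h x = 0" if "x \<in> S" for x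
  proof (rule linear_eq_0_on_span[OF h(1)])
    show "x \<in> span B" using that B by simp
    show "h y = 0" if "y \<in> B" for y
      using h(2)[of y] that B False by auto
  qed
  have hb: "h b = 1"
    using h(2)[of b] by simp
  have separated: "f s - norm (s - b) \<le> norm (t + b) - f t" if "s \<in> S" "t \<in> S" for s t
  proof -
    have "f s + f t = f (s + t)" by (simp add: linear_add[OF f])
    also have "\<dots> \<le> norm (s + t)" using that by (intro dom subspace_add[OF S])
    also have "\<dots> \<le> norm (s - b) + norm (t + b)"
      using norm_triangle_ineq[of "s - b" "t + b"] by simp
    finally show ?thesis by simp
  qed
  define c where "c = (SUP s\<in>S. f s - norm (s - b))"
  have S0: "0 \<in> S" using S by (rule subspace_0)
  have bdd: "bdd_above ((\<lambda>s. f s - norm (s - b)) ` S)"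
    using separated[OF _ S0] by (rule bdd_aboveI2)
  have lower: "f s - norm (s - b) \<le> c" if "s \<in> S" for s
    unfolding c_def by (rule cSUP_upper[OF that bdd])
  have upper: "c \<le> norm (t + b) - f t" if "t \<in> S" for t
    unfolding c_def using S0 separated that by (intro cSUP_least) auto
  define g where "g x = f x + h x * (c - f b)" for x
  have g: "linear g"
    unfolding g_def using f h(1)
    by (intro linearI) (simp_all add: linear_add linear_cmul algebra_simps)
  have gS: "g s = f s" if "s \<in> S" for s
    by (simp add: g_def hS that)
  have gb: "g b = c"
    by (simp add: g_def hb)
  have "g x \<le> norm x" if x: "x \<in> span (insert b S)" for x
  proof -
    obtain k where k: "x - k *\<^sub>R b \<in> S"
      using x S by (auto simp: span_insert span_eq_iff[THEN iffD2])
    define s where "s = x - k *\<^sub>R b"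
    have s: "s \<in> S" and xs: "x = s + k *\<^sub>R b" using k by (auto simp: s_def)
    have gx: "g x = f s + k * c"
      by (simp add: xs linear_add[OF g] linear_cmul[OF g] gS s gb)
    have sc: "(1/r) *\<^sub>R s \<in> S" "f ((1/r) *\<^sub>R s) = f s / r" for r
      by (simp_all add: subspace_scale[OF S] s linear_cmul[OF f])
    \<comment> \<open>After division by \<open>\<bar>k\<bar>\<close>, the upper bound on
      \<open>c\<close> settles \<open>k > 0\<close> and the lower bound settles
      \<open>k < 0\<close>.\<close>
    consider "k = 0" | "k > 0" | "k < 0" by linarith
    then show ?thesis
    proof cases
      case 1
      then show ?thesis using dom s xs gx by simp
    next
      case 2
      have "k * c \<le> k * (norm ((1/k) *\<^sub>R s + b) - f s / k)"
        using upper[OF sc(1)[of k]] 2 unfolding sc(2) by (intro mult_left_mono) auto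
      also have "\<dots> = norm (k *\<^sub>R ((1/k) *\<^sub>R s + b)) - f s"
        using 2 by (simp only: norm_scaleR) (simp add: field_simps)
      also have "k *\<^sub>R ((1/k) *\<^sub>R s + b) = x"
        using 2 by (simp add: xs scaleR_add_right)
      finally show ?thesis using gx by simp
    next
      case 3
      define r where "r = - k"
      have r: "r > 0" using 3 by (simp add: r_def)
      have "r * (f s / r - norm ((1/r) *\<^sub>R s - b)) \<le> r * c"
        using lower[OF sc(1)[of r]] r unfolding sc(2) by (intro mult_left_mono) auto
      moreover have "r * (f s / r - norm ((1/r) *\<^sub>R s - b)) = f s - norm (r *\<^sub>R ((1/r) *\<^sub>R s - b))"
        using r by (simp only: norm_scaleR) (simp add: field_simps)
      moreover have "r *\<^sub>R ((1/r) *\<^sub>R s - b) = x"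
        using r by (simp add: xs scaleR_diff_right r_def)
      ultimately have "f s - norm x \<le> r * c" by metis
      then show ?thesis using gx by (simp add: r_def)
    qed
  qed
  then show ?thesis using g gS by blast
qed

text \<open>Start on the line through \<open>z\<close> and add the elements of \<open>S\<close> one
  at a time. Only a finitely generated span has to be dominated, so induction takes the place of a
  maximality argument.\<close>

lemma norming_functional:
  fixes z :: "'a::real_normed_vector"
  assumes "finite S"
  shows "\<exists>f :: 'a \<Rightarrow> real. linear f \<and> f z = norm z \<and> (\<forall>x\<in>span (insert z S). f x \<le> norm x)"
  using assms
proof (induction S)
  case empty
  show ?case
  proof (cases "z = 0")
    case True
    then show ?thesis
      by (intro exI[of _ "\<lambda>_. 0"]) (auto simp: linear_iff)
  next
    case False
    then have "independent {z}" by simp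
    then obtain f :: "'a \<Rightarrow> real" where f: "linear f" "f z = norm z"
      using linear_independent_extend[of "{z}" norm] by auto
    have "f x \<le> norm x" if "x \<in> span {z}" for x
      using that by (auto simp: span_singleton linear_cmul[OF f(1)] f(2) mult_right_mono)
    with f show ?thesis by blast
  qed
next
  case (insert b S)
  then obtain f :: "'a \<Rightarrow> real" where f: "linear f" "f z = norm z" "\<And>x. x \<in> span (insert z S) \<Longrightarrow> f x \<le> norm x"
    by blast
  obtain g where g: "linear g" "\<And>x. x \<in> span (insert z S) \<Longrightarrow> g x = f x"
    "\<And>x. x \<in> span (insert b (span (insert z S))) \<Longrightarrow> g x \<le> norm x"
    using dominated_extension[OF f(1) subspace_span f(3), where b = b] by blast
  have "span (insert z (insert b S)) \<subseteq> span (insert b (span (insert z S)))"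
    by (rule span_mono) (auto intro: span_base)
  then show ?case
    using g f(2) by (intro exI[of _ g]) (auto simp: span_base)
qed

section \<open>Complementary hyperplanes and small subspaces over real or complex scalars\<close>

context banach_space_over
begin

lemma scale_scaleR: "sE (r *\<^sub>R c) x = r *\<^sub>R sE c x"
  by (simp add: scaleR_conv_of_real scale_of_real flip: scale_scale)

lemma finite_dim_subset: "finite_dim sE V \<Longrightarrow> U \<subseteq> V \<Longrightarrow> finite_dim sE U"
  by (auto simp: finite_dim_def)

lemma finite_dim_basis:
  assumes "finite_dim sE V"
  obtains B where "finite B" "B \<subseteq> V" "independent B" "V \<subseteq> span B" "card B = dim V"
proof -
  obtain B where B: "B \<subseteq> V" "independent B" "V \<subseteq> span B" "card B = dim V"
    using basis_exists by blast
  obtain C where "finite C" "V \<subseteq> span C"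
    using assms by (auto simp: finite_dim_def)
  then have "finite B"
    using independent_span_bound[of C B] B by blast
  with B that show ?thesis by blast
qed

text \<open>Scalars are real combinations of \<open>1\<close> and some \<open>i\<close>, so
  \<open>B\<close> together with its multiples by \<open>i\<close> spans over the reals. This opens
  \<open>V\<close> to the real Hahn-Banach argument.\<close>

lemma finite_dim_real_span:
  assumes "finite_dim sE V"
  obtains S where "finite S" "V \<subseteq> Real_Vector_Spaces.span S"
proof -
  obtain B where B: "finite B" "V \<subseteq> span B"
    using assms by (auto simp: finite_dim_def)
  obtain i :: 'k where i: "\<And>c. \<exists>a b. c = a *\<^sub>R 1 + b *\<^sub>R i"
    using scalar_decomposition by blast
  define S where "S = B \<union> sE i ` B"
  have "x \<in> Real_Vector_Spaces.span S" if "x \<in> span B" for x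
    using that
  proof (induction rule: span_induct_alt)
    case base
    show ?case by (rule Real_Vector_Spaces.span_zero)
  next
    case (step c b y)
    obtain r s where c: "c = r *\<^sub>R 1 + s *\<^sub>R i" using i by blast
    have "sE c b = r *\<^sub>R b + s *\<^sub>R sE i b"
      unfolding c by (simp add: scale_left_distrib scale_scaleR)
    moreover have "b \<in> S" "sE i b \<in> S" using step(1) by (auto simp: S_def)
    ultimately show ?case
      using step(2) by (auto intro!: real_vector.span_add real_vector.span_scale intro: real_vector.span_base)
  qed
  with B that[of S] show ?thesis by (auto simp: S_def)
qed

text \<open>If \<open>f\<close> norms \<open>z\<close> and vanishes on \<open>H\<close>, then
  \<open>norm z = f (z + h) \<le> norm (z + h)\<close>, and scaling gives every \<open>c\<close>.
  That \<open>z\<close> and \<open>H\<close> span \<open>V\<close> comes from solving real linear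
  equations for the coordinates of \<open>c\<close>.\<close>

lemma orthogonal_complement:
  assumes V: "subspace V" "finite_dim sE V" and z: "z \<in> V" "z \<noteq> 0"
  obtains H where "subspace H" "H \<subseteq> V" "\<And>c h. h \<in> H \<Longrightarrow> norm (sE c z) \<le> norm (sE c z + h)"
    "\<And>x. x \<in> V \<Longrightarrow> \<exists>c. x - sE c z \<in> H"
proof -
  obtain S where S: "finite S" "V \<subseteq> Real_Vector_Spaces.span S"
    using finite_dim_real_span[OF V(2)] by blast
  obtain f :: "'a \<Rightarrow> real" where f: "linear f" "f z = norm z"
    and dom0: "\<And>x. x \<in> Real_Vector_Spaces.span (insert z S) \<Longrightarrow> f x \<le> norm x"
    using norming_functional[OF S(1), of z] by blast
  have dom: "f x \<le> norm x" if "x \<in> V" for x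
    using dom0[of x] that S(2) Real_Vector_Spaces.span_mono[of S "insert z S"] by blast
  obtain i :: 'k where i: "\<And>c. \<exists>a b. c = a *\<^sub>R 1 + b *\<^sub>R i"
    using scalar_decomposition by blast
  \<comment> \<open>The functional is only real-linear, so the largest \<open>sE\<close>-invariant part of its kernel is taken.\<close>
  define H where "H = {x\<in>V. \<forall>c. f (sE c x) = 0}"
  have f_lin: "f (x + y) = f x + f y" "f (x - y) = f x - f y" "f (r *\<^sub>R x) = r * f x" "f 0 = 0" for x y r
    using f(1) by (simp_all add: linear_add linear_diff linear_cmul linear_0)
  have f_scale: "f (sE c x) = a * f x + b * f (sE i x)" if "c = a *\<^sub>R 1 + b *\<^sub>R i" for c x a b
    unfolding that by (simp add: scale_left_distrib scale_scaleR f_lin)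
  \<comment> \<open>As \<open>f (sE c x)\<close> is a real combination of \<open>f x\<close> and
    \<open>f (sE i x)\<close>, two real equations decide membership in \<open>H\<close>.\<close>
  have HI: "x \<in> H" if "x \<in> V" "f x = 0" "f (sE i x) = 0" for x
  proof -
    have "f (sE c x) = 0" for c
      using i[of c] f_scale that by fastforce
    then show ?thesis using that by (simp add: H_def)
  qed
  have f0: "f z > 0" using f z by simp
  show ?thesis
  proof (rule that[of H])
    show "subspace H"
      unfolding H_def using V(1)
      by (auto simp: subspace_def scale_right_distrib f_lin)
    show "H \<subseteq> V" by (auto simp: H_def)
    show "norm (sE c z) \<le> norm (sE c z + h)" if h: "h \<in> H" for c h
    proof (cases "c = 0")
      case False
      define h' where "h' = sE (inverse c) h"
      have h': "h' \<in> H" using \<open>subspace H\<close> h by (simp add: h'_def subspace_scale)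
      have "f (z + h') = norm z"
        using h' spec[of "\<lambda>c. f (sE c h') = 0" 1] by (simp add: H_def f_lin f)
      moreover have "z + h' \<in> V" using h' z V(1) by (simp add: H_def subspace_add)
      ultimately have "norm z \<le> norm (z + h')" using dom by metis
      moreover have "sE c z + h = sE c (z + h')"
        using False by (simp add: h'_def scale_right_distrib)
      ultimately show ?thesis by (simp add: norm_scale mult_left_mono)
    qed simp
    show "\<exists>c. x - sE c z \<in> H" if x: "x \<in> V" for x
    proof -
      \<comment> \<open>For \<open>c = a + b i\<close>, the condition
        \<open>x - sE c z \<in> H\<close> is the system \<open>a m + b p = f x\<close>,
        \<open>a p + b q = f (sE i x)\<close>, with determinant \<open>m q - p p\<close>.\<close>
      define m where "m = f z"
      define p where "p = f (sE i z)"
      define q where "q = f (sE i (sE i z))"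
      have V_c: "x - sE c z \<in> V" for c
        using x z V(1) by (simp add: subspace_diff subspace_scale)
      have fi: "f (sE i (sE c z)) = a * p + b * q" if "c = a *\<^sub>R 1 + b *\<^sub>R i" for a b c
      proof -
        have "sE i (sE c z) = sE c (sE i z)" by (simp add: mult.commute)
        then show ?thesis using f_scale[OF that] by (simp add: p_def q_def del: scale_scale)
      qed
      have fz: "f (sE c z) = a * m + b * p" if "c = a *\<^sub>R 1 + b *\<^sub>R i" for a b c
        using f_scale[OF that] by (simp add: p_def m_def)
      have m: "m > 0" using f0 by (simp add: m_def)
      show ?thesis
      proof (cases "m * q = p * p")
        case True
        \<comment> \<open>This degenerate case forces \<open>i\<close> to be a real scalar.\<close>
        define c where "c = (- p) *\<^sub>R 1 + m *\<^sub>R i"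
        \<comment> \<open>The pair \<open>(-p, m)\<close> is in the kernel of the singular matrix,
          so \<open>sE c z\<close> lies in \<open>H\<close>. Since \<open>f\<close> vanishes on all
          multiples of it but \<open>f z > 0\<close>, \<open>c\<close> must be 0.\<close>
        have "f (sE c z) = 0" "f (sE i (sE c z)) = 0"
          using fz[OF c_def] fi[OF c_def] True by (simp_all add: algebra_simps)
        then have "sE c z \<in> H" using z V(1) by (intro HI) (simp_all add: subspace_scale)
        then have "f (sE (inverse c) (sE c z)) = 0" by (simp add: H_def)
        then have "c = 0" using f0 by (cases "c = 0") simp_all
        then have "m *\<^sub>R i = p *\<^sub>R 1" by (simp add: c_def)
        then have "(1 / m) *\<^sub>R (m *\<^sub>R i) = (1 / m) *\<^sub>R (p *\<^sub>R 1)" by (rule arg_cong)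
        then have "i = (p / m) *\<^sub>R 1"
          using m by simp
        then have ir: "f (sE i y) = (p / m) * f y" for y
          using f_scale[of i "p / m" 0 y] by simp
        \<comment> \<open>With \<open>i\<close> a real scalar, the second equation follows from the
          first, which a real coefficient solves.\<close>
        define c' where "c' = (f x / m) *\<^sub>R (1::'k) + 0 *\<^sub>R i"
        have "f (x - sE c' z) = 0"
          using fz[OF c'_def] m by (simp add: f_lin)
        then have "x - sE c' z \<in> H"
          using V_c ir by (intro HI) simp_all
        then show ?thesis by blast
      next
        case False
        define D where "D = m * q - p * p"
        have D: "D \<noteq> 0" using False by (simp add: D_def)
        define u where "u = f x"
        define v where "v = f (sE i x)"
        \<comment> \<open>Cramer's rule for the two equations.\<close>
        define c where "c = ((q * u - p * v) / D) *\<^sub>R 1 + ((m * v - p * u) / D) *\<^sub>R i"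
        have "f (sE c z) = u"
          unfolding fz[OF c_def] times_divide_eq_left add_divide_distrib[symmetric]
          using D by (simp add: nonzero_divide_eq_eq) (simp add: D_def algebra_simps)
        moreover have "f (sE i (sE c z)) = v"
          unfolding fi[OF c_def] times_divide_eq_left add_divide_distrib[symmetric]
          using D by (simp add: nonzero_divide_eq_eq) (simp add: D_def algebra_simps)
        ultimately have "x - sE c z \<in> H"
          using V_c by (intro HI) (simp_all add: f_lin u_def v_def scale_right_diff_distrib)
        then show ?thesis by blast
      qed
    qed
  qed
qed

text \<open>The function \<open>p\<close> is a seminorm; it will be \<open>norm \<circ> msnd\<close> on the graph of the operator.\<close>

lemma small_subspace:
  fixes p :: "'a \<Rightarrow> real"
  assumes p_add: "\<And>x y. p (x + y) \<le> p x + p y" and p_scale: "\<And>c x. p (sE c x) = norm c * p x"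
    and small: "\<And>\<epsilon>. \<epsilon> > 0 \<Longrightarrow> \<exists>n. \<forall>Z. subspace Z \<and> Z \<subseteq> M \<and> finite_dim sE Z \<and> n \<le> dim Z \<longrightarrow>
        (\<exists>z\<in>Z. p z < \<epsilon> * norm z)"
    and "\<epsilon> > 0"
  shows "\<exists>n. \<forall>Z. subspace Z \<and> Z \<subseteq> M \<and> finite_dim sE Z \<and> n \<le> dim Z \<longrightarrow>
        (\<exists>L. subspace L \<and> L \<subseteq> Z \<and> d \<le> dim L \<and> (\<forall>x\<in>L. p x \<le> \<epsilon> * norm x))"
  using \<open>\<epsilon> > 0\<close>
proof (induction d arbitrary: \<epsilon>)
  case 0
  have "p 0 = 0" using p_scale[of 0 0] by simp
  then show ?case
    by (intro exI[of _ 0] allI impI exI[of _ "{0}"]) (auto simp: subspace_0)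
next
  case (Suc d)
  \<comment> \<open>A vector \<open>x = sE c z + l\<close> will satisfy
    \<open>norm (sE c z) \<le> norm x\<close> and \<open>norm l \<le> 2 * norm x\<close>; together
    they cost the factor 3.\<close>
  define \<delta> where "\<delta> = \<epsilon> / 3"
  have \<delta>: "\<delta> > 0" using Suc.prems by (simp add: \<delta>_def)
  obtain n1 where n1: "\<And>Z. subspace Z \<Longrightarrow> Z \<subseteq> M \<Longrightarrow> finite_dim sE Z \<Longrightarrow> n1 \<le> dim Z \<Longrightarrow>
      \<exists>z\<in>Z. p z < \<delta> * norm z"
    using small[OF \<delta>] by blast
  obtain n2 where n2: "\<And>Z. subspace Z \<Longrightarrow> Z \<subseteq> M \<Longrightarrow> finite_dim sE Z \<Longrightarrow> n2 \<le> dim Z \<Longrightarrow>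
      \<exists>L. subspace L \<and> L \<subseteq> Z \<and> d \<le> dim L \<and> (\<forall>x\<in>L. p x \<le> \<delta> * norm x)"
    using Suc.IH[OF \<delta>] by blast
  \<comment> \<open>\<open>n1\<close> provides the vector \<open>z\<close>, and
    \<open>Suc n2\<close> leaves dimension \<open>n2\<close> in the hyperplane
    \<open>H\<close>.\<close>
  have "\<exists>L. subspace L \<and> L \<subseteq> Z \<and> Suc d \<le> dim L \<and> (\<forall>x\<in>L. p x \<le> \<epsilon> * norm x)"
    if Z: "subspace Z" "Z \<subseteq> M" "finite_dim sE Z" and dimZ: "max n1 (Suc n2) \<le> dim Z" for Z
  proof -
    obtain z where z: "z \<in> Z" "p z < \<delta> * norm z"
      using n1[OF Z] dimZ by auto
    have "p 0 = 0" using p_scale[of 0 0] by simp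
    with z have z0: "z \<noteq> 0" by auto
    obtain H where H: "subspace H" "H \<subseteq> Z"
        "\<And>c h. h \<in> H \<Longrightarrow> norm (sE c z) \<le> norm (sE c z + h)"
        "\<And>x. x \<in> Z \<Longrightarrow> \<exists>c. x - sE c z \<in> H"
      using orthogonal_complement[OF Z(1,3) z(1) z0] by blast
    have fH: "finite_dim sE H" using finite_dim_subset[OF Z(3) H(2)] .
    obtain B where B: "finite B" "H \<subseteq> span B" "card B = dim H"
      using finite_dim_basis[OF fH] by metis
    have "Z \<subseteq> span (insert z B)"
      using H(4) B(2) by (auto simp: span_insert)
    then have "dim Z \<le> card (insert z B)"
      using B(1) by (intro dim_le_card) auto
    then have "n2 \<le> dim H"
      using dimZ B by (auto simp: card_insert_if split: if_splits)
    then obtain L where L: "subspace L" "L \<subseteq> H" "d \<le> dim L" "\<And>x. x \<in> L \<Longrightarrow> p x \<le> \<delta> * norm x"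
      using n2[OF H(1) _ fH] H(2) Z(2) by blast
    define L' where "L' = span (insert z L)"
    have sub: "L' \<subseteq> Z"
      unfolding L'_def using z L H Z by (intro span_minimal) auto
    obtain C where C: "finite C" "C \<subseteq> L" "independent C" "card C = dim L"
      using finite_dim_basis[OF finite_dim_subset[OF fH L(2)]] by metis
    \<comment> \<open>For \<open>h = - z\<close> and \<open>c = 1\<close> the norm inequality would
      give \<open>norm z \<le> 0\<close>. Hence adjoining \<open>z\<close> to \<open>L\<close>
      raises the dimension.\<close>
    have "z \<notin> H" using H(3)[of "- z" 1] z0 \<open>subspace H\<close> subspace_neg[of H z] by auto
    then have "z \<notin> span C"
      using C L span_minimal[of C L] by blast
    then have "independent (insert z C)" "z \<notin> C"
      using C by (auto simp: independent_insert span_base)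
    moreover have "insert z C \<subseteq> L'"
      using C by (auto simp: L'_def span_base)
    moreover obtain D where D: "finite D" "L' \<subseteq> span D" "card D = dim L'"
      using finite_dim_basis[OF finite_dim_subset[OF Z(3) sub]] by metis
    ultimately have "card (insert z C) \<le> dim L'"
      using independent_span_bound[of D "insert z C"] by auto
    then have dimL': "Suc d \<le> dim L'"
      using C L(3) \<open>z \<notin> C\<close> by simp
    have "p x \<le> \<epsilon> * norm x" if x: "x \<in> L'" for x
    proof -
      obtain c where c: "x - sE c z \<in> L"
        using x L(1) by (auto simp: L'_def span_insert span_eq_iff[THEN iffD2])
      define l where "l = x - sE c z"
      have l: "l \<in> L" "x = sE c z + l" using c by (auto simp: l_def)
      have cz: "norm (sE c z) \<le> norm x" using H(3) l L(2) by auto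
      have "norm l \<le> norm x + norm (sE c z)"
        unfolding l_def by (rule norm_triangle_ineq4)
      then have nl: "norm l \<le> 2 * norm x" using cz by simp
      have "p x \<le> norm c * p z + p l" using p_add[of "sE c z" l] l by (simp add: p_scale)
      also have "\<dots> \<le> norm c * (\<delta> * norm z) + \<delta> * norm l"
        using z L(4)[OF l(1)] by (intro add_mono mult_left_mono) auto
      also have "\<dots> = \<delta> * (norm (sE c z) + norm l)"
        by (simp add: norm_scale algebra_simps)
      also have "\<dots> \<le> \<delta> * (3 * norm x)"
        using cz nl \<delta> by (intro mult_left_mono) auto
      finally show ?thesis by (simp add: \<delta>_def)
    qed
    then show ?thesis
      using dimL' sub by (intro exI[of _ L']) (auto simp: L'_def)
  qed
  then show ?case by blast
qed

end

section \<open>Transfer of finite strict singularity to the graph\<close>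

lemma linear_graph:
  assumes "banach_space_over sX" "banach_space_over sY" "Vector_Spaces.linear sX sY A"
  shows "Vector_Spaces.linear sX (max_prod_scale sX sY) (\<lambda>x. MaxPair x (A x))"
proof -
  interpret X: banach_space_over sX by fact
  interpret Y: banach_space_over sY by fact
  interpret E: banach_space_over "max_prod_scale sX sY"
    by (intro banach_space_over_max_prod assms)
  interpret A: Vector_Spaces.linear sX sY A by fact
  show ?thesis
    by unfold_locales (simp_all add: max_prod_arith_defs max_prod_scale_def A.add A.scale)
qed

lemma linear_mfst:
  assumes "banach_space_over sX" "banach_space_over sY"
  shows "Vector_Spaces.linear (max_prod_scale sX sY) sX mfst"
proof -
  interpret X: banach_space_over sX by fact
  interpret E: banach_space_over "max_prod_scale sX sY"
    by (intro banach_space_over_max_prod assms)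
  show ?thesis
    by unfold_locales (simp_all add: max_prod_arith_defs max_prod_scale_def)
qed

text \<open>The graph map carries the projection of \<open>Z\<close> onto \<open>Z\<close>, so a
  large \<open>Z\<close> has a large projection, where some \<open>w\<close> has a small image.
  Passing from \<open>norm w\<close> to the norm of \<open>(w, A w)\<close> only enlarges the right
  side.\<close>

lemma finitely_strictly_singular_graph:
  assumes "banach_space_over sX" "banach_space_over sY" "finitely_strictly_singular sX sY A" "\<epsilon> > 0"
  shows "\<exists>n. \<forall>Z. module.subspace (max_prod_scale sX sY) Z \<and> Z \<subseteq> op_graph A \<and>
      finite_dim (max_prod_scale sX sY) Z \<and> n \<le> vector_space.dim (max_prod_scale sX sY) Z \<longrightarrow>
      (\<exists>z\<in>Z. norm (msnd z) < \<epsilon> * norm z)"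
proof -
  interpret X: banach_space_over sX by fact
  interpret E: banach_space_over "max_prod_scale sX sY"
    by (intro banach_space_over_max_prod assms)
  have A: "Vector_Spaces.linear sX sY A"
    using assms(3) by (simp add: finitely_strictly_singular_def bounded_operator_def)
  define g where "g x = MaxPair x (A x)" for x
  interpret g: Vector_Spaces.linear sX "max_prod_scale sX sY" g
    unfolding g_def by (rule linear_graph[OF assms(1,2) A])
  interpret fst: Vector_Spaces.linear "max_prod_scale sX sY" sX mfst
    by (rule linear_mfst[OF assms(1,2)])
  obtain n where n: "\<And>Z. X.subspace Z \<Longrightarrow> dim_at_least sX Z n \<Longrightarrow> \<exists>z\<in>Z. norm (A z) < \<epsilon> * norm z"
    using assms(3,4) unfolding finitely_strictly_singular_def by blast
  have "\<exists>z\<in>Z. norm (msnd z) < \<epsilon> * norm z"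
    if Z: "E.subspace Z" "Z \<subseteq> op_graph A" and dimZ: "n \<le> E.dim Z" for Z
  proof -
    define W where "W = mfst ` Z"
    have gW: "g (mfst q) = q" if "q \<in> Z" for q
      using Z(2) that by (auto simp: op_graph_def g_def)
    have ZW: "Z = g ` W"
      using gW by (auto simp: W_def image_iff)
    have "X.subspace W"
      unfolding W_def using Z(1) by (rule fst.subspace_image)
    moreover have "dim_at_least sX W n"
    proof (cases "finite_dim sX W")
      case True
      obtain B where B: "finite B" "W \<subseteq> X.span B" "card B = X.dim W"
        using X.finite_dim_basis[OF True] by metis
      have "Z \<subseteq> E.span (g ` B)"
        unfolding ZW g.span_image using B(2) by (rule image_mono)
      then have "E.dim Z \<le> card (g ` B)"
        using B(1) by (intro E.dim_le_card) auto
      also have "\<dots> \<le> X.dim W" using card_image_le[OF B(1)] B(3) by metis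
      finally show ?thesis using dimZ by (simp add: dim_at_least_def)
    qed (simp add: dim_at_least_def)
    ultimately obtain w where w: "w \<in> W" and "norm (A w) < \<epsilon> * norm w" using n by blast
    note this(2)
    also have "\<epsilon> * norm w \<le> \<epsilon> * norm (g w)"
      using assms(4) by (intro mult_left_mono) (simp_all add: norm_max_prod_def g_def)
    finally have "norm (A w) < \<epsilon> * norm (g w)" .
    then show ?thesis
      using w by (intro bexI[of _ "g w"]) (auto simp: ZW g_def)
  qed
  then show ?thesis by blast
qed

section \<open>Limits along index sets and the diagonal choice\<close>

lemma eventually_along: "eventually P (along N) \<longleftrightarrow> (\<exists>k. \<forall>n\<in>N. k \<le> n \<longrightarrow> P n)"
  unfolding along_def eventually_inf_principal eventually_sequentially by auto

lemma filterlim_along_at_top: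
  "filterlim (f :: nat \<Rightarrow> nat) at_top (along N) \<longleftrightarrow> (\<forall>d. \<exists>k. \<forall>n\<in>N. k \<le> n \<longrightarrow> d \<le> f n)"
  unfolding filterlim_at_top eventually_along ..

lemma along_mono: "N \<subseteq> N' \<Longrightarrow> along N \<le> along N'"
  unfolding along_def by (intro inf_mono) auto

text \<open>Read \<open>t d\<close> as the size required for the target \<open>d\<close>. Then
  \<open>m n\<close> is the largest target \<open>d \<le> n\<close> that \<open>f n\<close> can
  afford, and it tends to infinity however fast \<open>t\<close> grows.\<close>

lemma diagonal_choice:
  fixes f t :: "nat \<Rightarrow> nat"
  assumes N: "infinite N" and f: "filterlim f at_top (along N)"
  obtains N' m where "N' \<subseteq> N" "infinite N'" "\<And>n. n \<in> N' \<Longrightarrow> 1 \<le> m n" "\<And>n. n \<in> N' \<Longrightarrow> t (m n) \<le> f n"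
    "filterlim m at_top (along N')"
proof -
  \<comment> \<open>On \<open>N'\<close> the target 1 is admissible, so the maximum defining
    \<open>m n\<close> exists and is at least 1; only finitely many indices of \<open>N\<close> are
    lost.\<close>
  define N' where "N' = {n\<in>N. 1 \<le> n \<and> t 1 \<le> f n}"
  \<comment> \<open>The cap \<open>d \<le> n\<close> keeps the set finite even if \<open>t\<close>
    is bounded.\<close>
  define m where "m n = Max {d. d \<le> n \<and> t d \<le> f n}" for n
  have fin: "finite {d. d \<le> n \<and> t d \<le> f n}" for n by simp
  have mge: "d \<le> m n" if "d \<le> n" "t d \<le> f n" for d n
    unfolding m_def using that by (intro Max_ge) auto
  show ?thesis
  proof (rule that[of N' m])
    show "N' \<subseteq> N" by (auto simp: N'_def)
    obtain k where k: "\<And>n. n \<in> N \<Longrightarrow> k \<le> n \<Longrightarrow> t 1 \<le> f n"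
      using f unfolding filterlim_along_at_top by blast
    have "N \<subseteq> N' \<union> {..<max k 1}"
      using k by (auto simp: N'_def not_less)
    then show "infinite N'" using N finite_subset by blast
    show "1 \<le> m n" if "n \<in> N'" for n using that by (intro mge) (auto simp: N'_def)
    show "t (m n) \<le> f n" if "n \<in> N'" for n
    proof -
      have "{d. d \<le> n \<and> t d \<le> f n} \<noteq> {}" using that by (auto simp: N'_def)
      from Max_in[OF fin this] show ?thesis by (simp add: m_def)
    qed
    show "filterlim m at_top (along N')"
      unfolding filterlim_along_at_top
    proof
      fix d
      obtain k where k: "\<And>n. n \<in> N \<Longrightarrow> k \<le> n \<Longrightarrow> t d \<le> f n"
        using f unfolding filterlim_along_at_top by blast
      then show "\<exists>k. \<forall>n\<in>N'. k \<le> n \<longrightarrow> d \<le> m n"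
        by (intro exI[of _ "max k d"]) (auto simp: N'_def intro!: mge)
    qed
  qed
qed

section \<open>Adjustment with the graph of the null operator\<close>

text \<open>Approximate \<open>x n\<close> by \<open>(mfst (x n), 0)\<close>, with
  \<open>z = 0\<close> and without thinning the index set. The error is the norm of the second
  coordinate, at most \<open>\<epsilon> n\<close> on unit vectors.\<close>

lemma uniform_lambda_le_0:
  fixes L :: "nat \<Rightarrow> ('a::banach, 'b::banach) max_prod set"
  assumes L: "\<And>n q. n \<in> N \<Longrightarrow> q \<in> L n \<Longrightarrow> norm (msnd q) \<le> \<epsilon> n * norm q"
    and \<epsilon>: "(\<epsilon> \<longlongrightarrow> 0) (along N)"
  shows "uniform_lambda N L (\<lambda>_. op_graph (\<lambda>_. 0)) \<le> 0"
proof -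
  have "lower_uniformly_adjusted N L (\<lambda>_. op_graph (\<lambda>_. 0)) 0"
    unfolding lower_uniformly_adjusted_def
  proof (intro allI impI)
    fix \<eta> :: real and N2 :: "nat set" and x :: "nat \<Rightarrow> ('a, 'b) max_prod"
    assume \<eta>: "0 < \<eta>" and N2: "N2 \<subseteq> N \<and> infinite N2 \<and> (\<forall>n\<in>N2. x n \<in> L n \<and> norm (x n) = 1)"
    define y where "y n = MaxPair (mfst (x n)) (0::'b)" for n
    have norm_eq: "norm (x n - y n - 0) = norm (msnd (x n))" for n
      by (simp add: y_def max_prod_arith_defs norm_max_prod_def)
    have "eventually (\<lambda>n. \<epsilon> n < \<eta>) (along N2)"
      using order_tendstoD(2)[OF \<epsilon> \<eta>] along_mono[of N2 N] N2 by (auto elim: filter_leD)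
    moreover have "eventually (\<lambda>n. n \<in> N2) (along N2)"
      by (simp add: eventually_along)
    ultimately have "eventually (\<lambda>n. ereal (norm (x n - y n - 0)) \<le> ereal (0 + \<eta>)) (along N2)"
    proof eventually_elim
      case (elim n)
      then show ?case using L[of n "x n"] N2 unfolding norm_eq by auto
    qed
    then have "Limsup (along N2) (\<lambda>n. ereal (norm (x n - y n - 0))) \<le> ereal (0 + \<eta>)"
      by (rule Limsup_bounded)
    moreover have "\<forall>n\<in>N2. y n \<in> op_graph (\<lambda>_. 0)"
      by (auto simp: y_def op_graph_def)
    ultimately show "\<exists>N3 y z. N3 \<subseteq> N2 \<and> infinite N3 \<and> (\<forall>n\<in>N3. y n \<in> op_graph (\<lambda>_. 0)) \<and>
           Limsup (along N3) (\<lambda>n. ereal (norm (x n - y n - z))) \<le> ereal (0 + \<eta>)"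
      using N2 by blast
  qed
  then show ?thesis
    unfolding uniform_lambda_def by (intro cInf_lower bdd_belowI[of _ 0]) auto
qed

theorem lemma3p4p7:
  fixes sX :: "'k::real_or_complex \<Rightarrow> 'a::banach \<Rightarrow> 'a"
    and sY :: "'k \<Rightarrow> 'b::banach \<Rightarrow> 'b"
    and A :: "'a \<Rightarrow> 'b"
  assumes "banach_space_over sX"
    and "banach_space_over sY"
    and "(UNIV :: 'a set) \<noteq> {0}"
    and "finitely_strictly_singular sX sY A"
  shows "FSS_lambda_op sX sY A (\<lambda>_. 0) = 0"
proof -
  interpret Y: banach_space_over sY by fact
  interpret E: banach_space_over "max_prod_scale sX sY"
    by (intro banach_space_over_max_prod assms)
  \<comment> \<open>The same \<open>d\<close> governs dimension and smallness, so one diagonal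
    sequence drives both limits; \<open>Suc\<close> keeps the bound positive at
    \<open>d = 0\<close>.\<close>
  have "\<exists>n. \<forall>Z. E.subspace Z \<and> Z \<subseteq> op_graph A \<and> finite_dim (max_prod_scale sX sY) Z \<and> n \<le> E.dim Z \<longrightarrow>
      (\<exists>L. E.subspace L \<and> L \<subseteq> Z \<and> d \<le> E.dim L \<and> (\<forall>q\<in>L. norm (msnd q) \<le> 1 / real (Suc d) * norm q))" for d
  proof (rule E.small_subspace)
    show "norm (msnd (p + q)) \<le> norm (msnd p) + norm (msnd q)" for p q :: "('a, 'b) max_prod"
      by (simp add: plus_max_prod_def norm_triangle_ineq)
    show "norm (msnd (max_prod_scale sX sY c q)) = norm c * norm (msnd q)" for c q
      by (simp add: max_prod_scale_def Y.norm_scale)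
  qed (use finitely_strictly_singular_graph[OF assms(1,2,4)] in auto)
  then obtain t where t: "\<And>d Z. E.subspace Z \<Longrightarrow> Z \<subseteq> op_graph A \<Longrightarrow> finite_dim (max_prod_scale sX sY) Z \<Longrightarrow>
      t d \<le> E.dim Z \<Longrightarrow>
      \<exists>L. E.subspace L \<and> L \<subseteq> Z \<and> d \<le> E.dim L \<and> (\<forall>q\<in>L. norm (msnd q) \<le> 1 / real (Suc d) * norm q)"
    by metis
  have "\<exists>N3 L. N3 \<subseteq> N2 \<and> infinite N3 \<and>
      (\<forall>n\<in>N3. E.subspace (L n) \<and> L n \<subseteq> K n \<and> L n \<noteq> {0}) \<and>
      filterlim (\<lambda>n. E.dim (L n)) at_top (along N3) \<and>
      uniform_lambda N3 L (\<lambda>_. op_graph (\<lambda>_. 0)) \<le> 0"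
    if N2: "infinite N2"
      and K: "\<And>n. n \<in> N2 \<Longrightarrow> E.subspace (K n) \<and> K n \<subseteq> op_graph A \<and> finite_dim (max_prod_scale sX sY) (K n)"
      and dimK: "filterlim (\<lambda>n. E.dim (K n)) at_top (along N2)" for N2 K
  proof -
    obtain N3 m where N3: "N3 \<subseteq> N2" "infinite N3" and m1: "\<And>n. n \<in> N3 \<Longrightarrow> 1 \<le> m n"
      and tm: "\<And>n. n \<in> N3 \<Longrightarrow> t (m n) \<le> E.dim (K n)" and m: "filterlim m at_top (along N3)"
      using diagonal_choice[OF N2 dimK, where t = t] by blast
    have "\<forall>n\<in>N3. \<exists>L. E.subspace L \<and> L \<subseteq> K n \<and> m n \<le> E.dim L \<and>
        (\<forall>q\<in>L. norm (msnd q) \<le> 1 / real (Suc (m n)) * norm q)"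
      using t tm K N3 by (meson subsetD)
    then obtain L where L: "\<And>n. n \<in> N3 \<Longrightarrow> E.subspace (L n) \<and> L n \<subseteq> K n \<and> m n \<le> E.dim (L n) \<and>
        (\<forall>q\<in>L n. norm (msnd q) \<le> 1 / real (Suc (m n)) * norm q)"
      by metis
    \<comment> \<open>Here \<open>m n \<ge> 1\<close> matters, since the zero subspace has dimension
      0.\<close>
    have "L n \<noteq> {0}" if "n \<in> N3" for n
    proof
      assume "L n = {0}"
      then have "E.dim (L n) \<le> card ({} :: ('a, 'b) max_prod set)"
        by (intro E.dim_le_card) auto
      then show False using L[OF that] m1[OF that] by simp
    qed
    moreover have "filterlim (\<lambda>n. E.dim (L n)) at_top (along N3)"
      using m L unfolding filterlim_along_at_top by (meson le_trans)
    moreover have "((\<lambda>n. 1 / real (Suc (m n))) \<longlongrightarrow> 0) (along N3)"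
      by (rule filterlim_compose[OF LIMSEQ_Suc[OF lim_1_over_n] m, unfolded o_def])
    then have "uniform_lambda N3 L (\<lambda>_. op_graph (\<lambda>_. 0)) \<le> 0"
      using L by (intro uniform_lambda_le_0) auto
    ultimately show ?thesis using N3 L by (intro exI[of _ N3] exI[of _ L]) simp
  qed
  \<comment> \<open>The value 0 is itself admissible and no admissible value is negative, so the
    infimum is attained there.\<close>
  then show ?thesis
    unfolding FSS_lambda_op_def FSS_lambda_op_seq_def FSS_lambda_def
    by (intro cInf_eq_minimum CollectI conjI order_refl allI impI) blast+
qed

end
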